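(* Let $p$ and $q$ be continuous functions on an interval $I\subseteq\mathbb{R}$, $a\in I$, $\alpha\in(0,1]$ and $n\in\mathbb{R}\setminus\{1\}$, and consider the Bernoulli fractional equation $$G_T^{\alpha}y+p(t)y=q(t)y^n. \qquad (B)$$ Then the following statements hold. (1) For each $C\in\mathbb{R}$, the function $$y(t)=\Big[e^{-(1-n)J_{T,a}^{\alpha}(p)(t)}\Big((1-n)J_{T,a}^{\alpha}\big(q\,e^{(1-n)J_{T,a}^{\alpha}(p)}\big)(t)+C\Big)\Big]^{1/(1-n)} \qquad (S)$$ is a solution of the Bernoulli fractional equation (B). (2) For each $t_0\in I$ and $y_0\in\mathbb{R}$, let $y(t;t_0,y_0)$ be the function in (S) with $$C=y_0^{1-n}e^{(1-n)J_{T,a}^{\alpha}(p)(t_0)}-(1-n)J_{T,a}^{\alpha}\big(q\,e^{(1-n)J_{T,a}^{\alpha}(p)}\big)(t_0).$$ If $(y_0^{1-n})^{1/(1-n)}=y_0$ and $y(t;t_0,y_0)$ is defined in some right or left neighborhood $U\subseteq I$ of $t_0$, then $y(t;t_0,y_0)$ is a solution of (B) on $U$ satisfying the initial condition $y(t_0;t_0,y_0)=y_0$. (3) For each $t_0\in I$ and $y_0>0$ there exists a unique solution of (B) satisfying the initial value $y(t_0)=y_0$, given by $y(t;t_0,y_0)$. (4) If $n\in(1,\infty)\cap\mathbb{Q}$ and $1/(1-n)=r/s$ with $s$ an odd integer, then for each $t_0\in I$ and $y_0\in\mathbb{R}$ there exists a unique solution of (B) satisfying the initial value $y(t_0)=y_0$,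 given by $y(t;t_0,y_0)$.
   Context: $T(t,\alpha)$ is a given kernel: for the fixed $\alpha$, $t\mapsto T(t,\alpha)$ is a positive continuous function on $I$. For $\alpha\in(0,1]$, the generalized derivative of order $\alpha$ of $f:I\to\mathbb{R}$ at $t\in I$ is $$G_T^{\alpha}f(t)=\lim_{h\to0}\frac{f(t)-f\big(t-hT(t,\alpha)\big)}{h},$$ where at $t=\min I$ (respectively $t=\max I$), if it exists, the limit is taken as $h\to0^-$ (respectively $h\to0^+$). For a locally integrable function $f$ on $I$ and $a,t\in I$, $$J_{T,a}^{\alpha}(f)(t)=\int_a^t\frac{f(\omega)}{T(\omega,\alpha)}\,d\omega .$$ The expression $e^{(1-n)J_{T,a}^{\alpha}(p)}$ denotes the function $s\mapsto e^{(1-n)J_{T,a}^{\alpha}(p)(s)}$.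
   Formalization: In (1),(2), (S) counts as defined only where y^n exists and y^{1-n} equals the bracket; in (3), for 0<n<1, uniqueness holds while the bracket is nonzero or the solution is positive; in (4), y0^n must exist (y0≥0 if r is even), and for y0=0 the solution is zero. *)

theory Defs
  imports "HOL-Analysis.Analysis"
begin

text \<open>
  Real powers \<open>x ^ a\<close> with a real exponent are partial: they are defined for every
  \<open>x > 0\<close>, for \<open>x = 0\<close> when \<open>a \<ge> 0\<close> (with \<open>0 ^ 0 = 1\<close>), and for \<open>x < 0\<close> when \<open>a\<close> is a
  fraction \<open>m / k\<close> with odd denominator, in which case the value is the \<open>m\<close>-th power of the
  real \<open>k\<close>-th root. The function \<open>powr\<close> cannot be used for \<open>x < 0\<close>, as it ignores the sign
  of \<open>x\<close> there.
\<close>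

definition rpow_defined :: "real \<Rightarrow> real \<Rightarrow> bool" where
  "rpow_defined x a \<longleftrightarrow>
     x > 0 \<or> x = 0 \<and> a \<ge> 0 \<or>
     x < 0 \<and> (\<exists>(m::int) (k::nat). odd k \<and> a = of_int m / of_nat k)"

definition rpow :: "real \<Rightarrow> real \<Rightarrow> real" where
  "rpow x a =
     (if x > 0 then x powr a
      else if x = 0 then (if a = 0 then 1 else 0)
      else if \<exists>(m::int) (k::nat). odd k \<and> even m \<and> a = of_int m / of_nat k then \<bar>x\<bar> powr a
      else - (\<bar>x\<bar> powr a))"

lemma rpow_neg_fraction:
  fixes x :: real and m :: int and k :: nat
  assumes x: "x < 0" and k: "odd k"
  shows "rpow x (of_int m / of_nat k) = root k x powi m"
proof -
  have k0: "k > 0" using k by (rule odd_pos)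
  have par: "even m' \<longleftrightarrow> even m"
    if "odd k'" "(of_int m / of_nat k :: real) = of_int m' / of_nat k'" for m' :: int and k' :: nat
  proof -
    have "k' > 0" using that(1) by (rule odd_pos)
    then have "real_of_int (m * int k') = real_of_int (m' * int k)"
      using that(2) k0 by (simp add: field_simps)
    then have "m * int k' = m' * int k" by (simp only: of_int_eq_iff)
    then have "even (m * int k') \<longleftrightarrow> even (m' * int k)" by simp
    then show ?thesis using that(1) k by simp
  qed
  have ex: "(\<exists>(m'::int) (k'::nat). odd k' \<and> even m' \<and>
      (of_int m / of_nat k :: real) = of_int m' / of_nat k') \<longleftrightarrow> even m"
    using par k by blast
  have pos: "root k \<bar>x\<bar> > 0" using x k0 by simp
  have "\<bar>x\<bar> powr (of_int m / of_nat k) = (\<bar>x\<bar> powr (1 / of_nat k)) powr of_int m"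
    by (simp add: powr_powr)
  also have "\<dots> = root k \<bar>x\<bar> powi m"
    using x k0 pos by (simp add: root_powr_inverse powr_real_of_int')
  finally have *: "\<bar>x\<bar> powr (of_int m / of_nat k) = root k \<bar>x\<bar> powi m" .
  have **: "root k x = - root k \<bar>x\<bar>" using x by (simp add: real_root_minus)
  show ?thesis
    unfolding rpow_def ex ** using x * by (auto simp: power_int_minus_left)
qed

text \<open>
  The value of \<open>f\<close> outside \<open>I\<close> is irrelevant: at an endpoint of \<open>I\<close> the limit is one-sided,
  with \<open>h\<close> of the sign for which \<open>t - h * T t \<alpha>\<close> points into \<open>I\<close>.
\<close>

definition has_gen_deriv ::
  "(real \<Rightarrow> real \<Rightarrow> real) \<Rightarrow> real \<Rightarrow> real set \<Rightarrow> (real \<Rightarrow> real) \<Rightarrow> real \<Rightarrow> real \<Rightarrow> bool" where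
  "has_gen_deriv T \<alpha> I f D t \<longleftrightarrow>
     ((\<lambda>h. (f t - f (t - h * T t \<alpha>)) / h) \<longlongrightarrow> D)
       (if \<forall>s\<in>I. t \<le> s then at_left 0
        else if \<forall>s\<in>I. s \<le> t then at_right 0
        else at 0)"

definition gen_int ::
  "(real \<Rightarrow> real \<Rightarrow> real) \<Rightarrow> real \<Rightarrow> real \<Rightarrow> (real \<Rightarrow> real) \<Rightarrow> real \<Rightarrow> real" where
  "gen_int T \<alpha> a f t = (LBINT w=a..t. f w / T w \<alpha>)"

definition subinterval :: "real set \<Rightarrow> real set \<Rightarrow> bool" where
  "subinterval U I \<longleftrightarrow> is_interval U \<and> interior U \<noteq> {} \<and> U \<subseteq> I"

definition bernoulli_solution_on ::
  "(real \<Rightarrow> real \<Rightarrow> real) \<Rightarrow> real \<Rightarrow> (real \<Rightarrow> real) \<Rightarrow> (real \<Rightarrow> real) \<Rightarrow> real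
     \<Rightarrow> real set \<Rightarrow> (real \<Rightarrow> real) \<Rightarrow> bool" where
  "bernoulli_solution_on T \<alpha> p q n U y \<longleftrightarrow>
     (\<forall>t\<in>U. rpow_defined (y t) n \<and>
       (\<exists>D. has_gen_deriv T \<alpha> U y D t \<and> D + p t * y t = q t * rpow (y t) n))"

definition bernoulli_ivp_solution_on ::
  "(real \<Rightarrow> real \<Rightarrow> real) \<Rightarrow> real \<Rightarrow> (real \<Rightarrow> real) \<Rightarrow> (real \<Rightarrow> real) \<Rightarrow> real
     \<Rightarrow> real \<Rightarrow> real \<Rightarrow> real set \<Rightarrow> (real \<Rightarrow> real) \<Rightarrow> bool" where
  "bernoulli_ivp_solution_on T \<alpha> p q n t0 y0 U y \<longleftrightarrow>
     t0 \<in> U \<and> bernoulli_solution_on T \<alpha> p q n U y \<and> y t0 = y0"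

definition bernoulli_bracket ::
  "(real \<Rightarrow> real \<Rightarrow> real) \<Rightarrow> real \<Rightarrow> (real \<Rightarrow> real) \<Rightarrow> (real \<Rightarrow> real) \<Rightarrow> real
     \<Rightarrow> real \<Rightarrow> real \<Rightarrow> real \<Rightarrow> real" where
  "bernoulli_bracket T \<alpha> p q n a C t =
     exp (- (1 - n) * gen_int T \<alpha> a p t) *
       ((1 - n) * gen_int T \<alpha> a (\<lambda>s. q s * exp ((1 - n) * gen_int T \<alpha> a p s)) t + C)"

definition bernoulli_formula ::
  "(real \<Rightarrow> real \<Rightarrow> real) \<Rightarrow> real \<Rightarrow> (real \<Rightarrow> real) \<Rightarrow> (real \<Rightarrow> real) \<Rightarrow> real
     \<Rightarrow> real \<Rightarrow> real \<Rightarrow> real \<Rightarrow> real" where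
  "bernoulli_formula T \<alpha> p q n a C t =
     rpow (bernoulli_bracket T \<alpha> p q n a C t) (1 / (1 - n))"

text \<open>
  The solution formula comes from the substitution \<open>u = y ^ (1 - n)\<close>, where \<open>u\<close> is the
  bracket. So it is regarded as defined where the \<open>1/(1-n)\<close>-th power \<open>y\<close> of \<open>u\<close> exists and
  inverts this substitution, and where the term \<open>y ^ n\<close> of the equation exists. This matters
  only for \<open>u \<le> 0\<close>. For instance, if \<open>n = 1/2\<close>, \<open>p = 0\<close>, \<open>q = T = 1\<close>, then \<open>u t = t / 2\<close> and
  \<open>y t = t\<^sup>2 / 4\<close> solves \<open>y' = y ^ (1/2)\<close> only where \<open>u t \<ge> 0\<close>.
\<close>

definition bernoulli_root_defined :: "real \<Rightarrow> real \<Rightarrow> bool" where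
  "bernoulli_root_defined n u \<longleftrightarrow>
     rpow_defined u (1 / (1 - n)) \<and>
     (let y = rpow u (1 / (1 - n)) in
        rpow_defined y n \<and> rpow_defined y (1 - n) \<and> rpow y (1 - n) = u)"

definition bernoulli_const ::
  "(real \<Rightarrow> real \<Rightarrow> real) \<Rightarrow> real \<Rightarrow> (real \<Rightarrow> real) \<Rightarrow> (real \<Rightarrow> real) \<Rightarrow> real
     \<Rightarrow> real \<Rightarrow> real \<Rightarrow> real \<Rightarrow> real" where
  "bernoulli_const T \<alpha> p q n a t0 y0 =
     rpow y0 (1 - n) * exp ((1 - n) * gen_int T \<alpha> a p t0)
       - (1 - n) * gen_int T \<alpha> a (\<lambda>s. q s * exp ((1 - n) * gen_int T \<alpha> a p s)) t0"

text \<open>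
  For \<open>y0 = 0\<close> and \<open>n > 1\<close> the constant \<open>C\<close> involves a negative power of zero. This is read
  as \<open>C = \<infinity>\<close>; as \<open>1 / (1 - n) < 0\<close>, the formula then gives the zero function.
\<close>

definition bernoulli_ivp ::
  "(real \<Rightarrow> real \<Rightarrow> real) \<Rightarrow> real \<Rightarrow> (real \<Rightarrow> real) \<Rightarrow> (real \<Rightarrow> real) \<Rightarrow> real
     \<Rightarrow> real \<Rightarrow> real \<Rightarrow> real \<Rightarrow> real \<Rightarrow> real" where
  "bernoulli_ivp T \<alpha> p q n a t0 y0 t =
     (if y0 = 0 \<and> n > 1 then 0
      else bernoulli_formula T \<alpha> p q n a (bernoulli_const T \<alpha> p q n a t0 y0) t)"

text \<open>
  The largest subinterval of \<open>I\<close> around \<open>t0\<close> on which the bracket does not vanish. Where the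
  bracket vanishes, the solution blows up (\<open>n > 1\<close>) or reaches the value \<open>0\<close> (\<open>n < 1\<close>).
\<close>

definition bernoulli_ivp_dom ::
  "(real \<Rightarrow> real \<Rightarrow> real) \<Rightarrow> real \<Rightarrow> (real \<Rightarrow> real) \<Rightarrow> (real \<Rightarrow> real) \<Rightarrow> real
     \<Rightarrow> real set \<Rightarrow> real \<Rightarrow> real \<Rightarrow> real \<Rightarrow> real set" where
  "bernoulli_ivp_dom T \<alpha> p q n I a t0 y0 =
     (if y0 = 0 \<and> n > 1 then I
      else connected_component_set
        {t \<in> I. bernoulli_bracket T \<alpha> p q n a (bernoulli_const T \<alpha> p q n a t0 y0) t \<noteq> 0} t0)"

end

theory Submission
  imports Defs
begin


text \<open>
  On an interval, the generalized derivative is \<open>T\<close> times the ordinary one, and the substitution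
  \<open>u = y ^ (1 - n)\<close> turns the Bernoulli equation into the linear equation
  \<open>T u' = (1 - n) (q - p u)\<close>, which the bracket satisfies and whose solutions are determined by
  one value. The substitution can be inverted where \<open>y \<noteq> 0\<close>; for \<open>y < 0\<close> this requires that
  \<open>1 - n\<close> is a quotient of odd integers, and then \<open>n\<close> has even numerator and odd denominator.

  A solution with nonzero initial value never vanishes if \<open>n < 0\<close>, as \<open>0 ^ n\<close> is undefined, or if
  \<open>n > 1\<close>. For \<open>n = 0\<close> the equation is linear in \<open>y\<close> itself. For \<open>0 < n < 1\<close> a solution
  starting from a positive value can first vanish only where the bracket does.
\<close>

subsection \<open>Real powers with negative base\<close>

text \<open>The exponents for which the power is an odd function and a bijection of the nonzero
  reals. Integer denominators, instead of natural ones, make inversion a plain exchange of numerator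
  and denominator.\<close>

definition odd_fraction :: "real \<Rightarrow> bool" where
  "odd_fraction a \<longleftrightarrow> (\<exists>(m::int) (k::int). odd m \<and> odd k \<and> a = of_int m / of_int k)"

definition even_fraction :: "real \<Rightarrow> bool" where
  "even_fraction a \<longleftrightarrow> (\<exists>(m::int) (k::int). even m \<and> odd k \<and> a = of_int m / of_int k)"

text \<open>A negative denominator becomes positive by moving its sign to the numerator, so
  \<open>P\<close> has to be invariant under negation.\<close>

lemma odd_denominator_int_iff_nat:
  assumes P: "\<And>m::int. P (- m) \<longleftrightarrow> P m"
  shows "(\<exists>(m::int) (k::int). P m \<and> odd k \<and> a = real_of_int m / of_int k) \<longleftrightarrow>
    (\<exists>(m::int) (k::nat). odd k \<and> P m \<and> a = of_int m / of_nat k)"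
proof (intro iffI; elim exE conjE)
  fix m k :: int assume *: "P m" "odd k" "a = of_int m / of_int k"
  show "\<exists>(m::int) (k::nat). odd k \<and> P m \<and> a = of_int m / of_nat k"
  proof (cases "k > 0")
    case True
    then show ?thesis using * by (intro exI[of _ m] exI[of _ "nat k"]) (auto simp: even_nat_iff)
  next
    case False
    then show ?thesis using * P
      by (intro exI[of _ "- m"] exI[of _ "nat (- k)"]) (auto simp: even_nat_iff)
  qed
next
  fix m :: int and k :: nat assume "P m" "odd k" "a = of_int m / of_nat k"
  then show "\<exists>(m::int) (k::int). P m \<and> odd k \<and> a = real_of_int m / of_int k"
    by (intro exI[of _ m] exI[of _ "int k"]) auto
qed

lemma even_fraction_nat:
  "even_fraction a \<longleftrightarrow> (\<exists>(m::int) (k::nat). odd k \<and> even m \<and> a = of_int m / of_nat k)"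
  unfolding even_fraction_def by (rule odd_denominator_int_iff_nat) simp

lemma odd_denominator_cases:
  "(\<exists>(m::int) (k::nat). odd k \<and> a = of_int m / of_nat k) \<longleftrightarrow> even_fraction a \<or> odd_fraction a"
  unfolding even_fraction_def odd_fraction_def
  using odd_denominator_int_iff_nat[of "\<lambda>_. True" a] by auto

text \<open>Cross-multiplication would equate an odd with an even integer. Hence the power of a
  negative base with such an exponent is negative.\<close>

lemma odd_fraction_not_even:
  assumes "odd_fraction a" shows "\<not> even_fraction a"
proof
  assume "even_fraction a"
  then obtain m k m' k' :: int where *: "odd m" "odd k" "a = of_int m / of_int k"
    "even m'" "odd k'" "a = of_int m' / of_int k'"
    using assms unfolding even_fraction_def odd_fraction_def by blast
  then have "k \<noteq> 0" "k' \<noteq> 0" by auto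
  with * have "real_of_int (m * k') = of_int (m' * k)"
    by (simp add: frac_eq_eq)
  then have "m * k' = m' * k" by (simp only: of_int_eq_iff)
  then have "even (m * k') \<longleftrightarrow> even (m' * k)" by simp
  with * show False by simp
qed

lemma odd_fraction_inverse: "odd_fraction a \<Longrightarrow> odd_fraction (1 / a)"
  unfolding odd_fraction_def by force

text \<open>Here \<open>n = (k - m) / k\<close> with \<open>k - m\<close> even, so
  \<open>y ^ n\<close> is \<open>\<bar>y\<bar> powr n\<close> also for negative
  \<open>y\<close>.\<close>

lemma odd_fraction_one_minus:
  assumes "odd_fraction (1 - n)" shows "even_fraction n"
proof -
  obtain m k :: int where *: "odd m" "odd k" "1 - n = of_int m / of_int k"
    using assms unfolding odd_fraction_def by blast
  then have "k \<noteq> 0" by auto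
  then have "n = of_int (k - m) / of_int k" using *(3) by (simp add: diff_divide_distrib)
  moreover have "even (k - m)" using * by simp
  ultimately show ?thesis using *(2) unfolding even_fraction_def by blast
qed

text \<open>Turns the parity condition on \<open>1 / (1 - n)\<close> into invertibility of the
  substitution. With \<open>n = m / k\<close> and \<open>k\<close> odd, both fractions combine to
  \<open>s * k = (k - m) * r\<close>, whose left side is odd.\<close>

lemma odd_fraction_one_minusI:
  assumes "even_fraction n \<or> odd_fraction n" "odd s" "1 / (1 - n) = of_int r / of_int s" "n \<noteq> 1"
  shows "odd_fraction (1 - n)"
proof -
  obtain m k :: int where mk: "odd k" "n = of_int m / of_int k"
    using assms(1) unfolding even_fraction_def odd_fraction_def by blast
  have nz: "k \<noteq> 0" "s \<noteq> 0" using mk assms(2) by auto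
  then have 1: "(1 - n) * of_int k = of_int (k - m)" using mk(2) by (simp add: field_simps)
  have "of_int s = (1 - n) * of_int r" using assms(3,4) nz by (simp add: field_simps)
  then have "real_of_int (s * k) = of_int ((k - m) * r)" using 1 by (simp add: ac_simps)
  then have "s * k = (k - m) * r" by (simp only: of_int_eq_iff)
  moreover have "odd (s * k)" using assms(2) mk(1) by simp
  ultimately have "odd (k - m)" by simp
  moreover have "1 - n = of_int (k - m) / of_int k" using 1 nz by (simp add: field_simps)
  ultimately show ?thesis using mk(1) unfolding odd_fraction_def by blast
qed

lemma rpow_pos [simp]: "0 < x \<Longrightarrow> rpow x a = x powr a"
  by (simp add: rpow_def)

lemma rpow_zero: "rpow 0 a = (if a = 0 then 1 else 0)"
  by (simp add: rpow_def)

lemma rpow_neg: "x < 0 \<Longrightarrow> rpow x a = (if even_fraction a then \<bar>x\<bar> powr a else - (\<bar>x\<bar> powr a))"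
  by (simp add: rpow_def even_fraction_nat)

text \<open>This form and the next one treat both signs of the base at once; the exponent is
  restricted only for negative bases.\<close>

lemma rpow_even_fraction: "x \<noteq> 0 \<Longrightarrow> (x < 0 \<Longrightarrow> even_fraction a) \<Longrightarrow> rpow x a = \<bar>x\<bar> powr a"
  by (cases "x > 0") (auto simp: rpow_neg)

lemma rpow_odd_fraction:
  "x \<noteq> 0 \<Longrightarrow> (x < 0 \<Longrightarrow> odd_fraction a) \<Longrightarrow> rpow x a = sgn x * \<bar>x\<bar> powr a"
  by (cases "x > 0") (auto simp: rpow_neg odd_fraction_not_even)

lemma rpow_one: "rpow x 1 = x"
proof -
  have "odd_fraction 1" unfolding odd_fraction_def by (intro exI[of _ 1]) simp
  then show ?thesis by (cases "x = 0") (auto simp: rpow_zero rpow_odd_fraction sgn_mult_abs)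
qed

lemma abs_rpow: "x \<noteq> 0 \<Longrightarrow> \<bar>rpow x a\<bar> = \<bar>x\<bar> powr a"
  by (simp add: rpow_def)

lemma rpow_defined_iff:
  "rpow_defined x a \<longleftrightarrow> 0 < x \<or> x = 0 \<and> 0 \<le> a \<or> x < 0 \<and> (even_fraction a \<or> odd_fraction a)"
  unfolding rpow_defined_def odd_denominator_cases ..

lemma sgn_rpow_odd_fraction:
  "x \<noteq> 0 \<Longrightarrow> (x < 0 \<Longrightarrow> odd_fraction a) \<Longrightarrow> sgn (rpow x a) = sgn x"
  by (simp add: rpow_odd_fraction sgn_mult)

text \<open>Such a power keeps the sign, and on absolute values the exponents \<open>a\<close> and
  \<open>1 / a\<close> cancel.\<close>

lemma rpow_rpow_inverse:
  assumes "x \<noteq> 0" "x < 0 \<Longrightarrow> odd_fraction a" "a \<noteq> 0"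
  shows "rpow (rpow x a) (1 / a) = x"
proof -
  have "sgn (rpow x a) = sgn x" using assms(1,2) by (rule sgn_rpow_odd_fraction)
  then have "rpow x a \<noteq> 0" "rpow x a < 0 \<longleftrightarrow> x < 0"
    using assms(1) by (auto simp: sgn_if split: if_splits)
  then have "rpow (rpow x a) (1 / a) = sgn (rpow x a) * \<bar>rpow x a\<bar> powr (1 / a)"
    by (intro rpow_odd_fraction odd_fraction_inverse assms(2)) auto
  also have "\<dots> = x"
    using assms(1,3) \<open>sgn (rpow x a) = sgn x\<close> by (simp add: abs_rpow powr_powr sgn_mult_abs)
  finally show ?thesis .
qed

section \<open>Derivative and continuity of the power away from zero\<close>

lemma eventually_sgn_eq:
  fixes x :: real
  assumes "x \<noteq> 0"
  shows "eventually (\<lambda>y. sgn y = sgn x) (nhds x)"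
proof (cases "x > 0")
  case True
  then have "eventually (\<lambda>y. y > 0) (nhds x)" using eventually_nhds_in_open[of "{0<..}" x] by simp
  then show ?thesis using True by (auto elim!: eventually_mono)
next
  case False
  then have "x < 0" using assms by simp
  then have "eventually (\<lambda>y. y < 0) (nhds x)" using eventually_nhds_in_open[of "{..<0}" x] by simp
  then show ?thesis using \<open>x < 0\<close> by (auto elim!: eventually_mono)
qed

text \<open>Near \<open>x\<close> the sign is constant, so the power is
  \<open>sgn x * (sgn x * y) powr b\<close> there. The chain rule yields a second factor
  \<open>sgn x\<close>, and the two cancel.\<close>

lemma has_real_derivative_rpow:
  assumes "x \<noteq> 0" "x < 0 \<Longrightarrow> odd_fraction b"
  shows "((\<lambda>x. rpow x b) has_real_derivative b * \<bar>x\<bar> powr (b - 1)) (at x)"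
proof -
  have abs: "\<bar>y\<bar> = sgn x * y" if "sgn y = sgn x" for y
    using that abs_sgn[of y] by (simp add: mult.commute)
  have "((\<lambda>y. sgn x * (sgn x * y) powr b) has_real_derivative
      sgn x * (b * (sgn x * x) powr (b - 1) * (sgn x * 1))) (at x)"
    using assms(1) abs[OF refl]
    by (intro DERIV_cmult DERIV_chain2[OF has_real_derivative_powr] DERIV_ident) auto
  moreover have "eventually (\<lambda>y. rpow y b = sgn x * (sgn x * y) powr b) (nhds x)"
    using eventually_sgn_eq[OF assms(1)]
  proof eventually_elim
    case (elim y)
    then have "y \<noteq> 0" "y < 0 \<longleftrightarrow> x < 0" using assms(1) by (auto simp: sgn_if split: if_splits)
    then show ?case using rpow_odd_fraction[of y b] assms elim abs[OF elim] by auto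
  qed
  moreover have "sgn x * (b * (sgn x * x) powr (b - 1) * (sgn x * 1)) = b * \<bar>x\<bar> powr (b - 1)"
    using assms(1) by (simp add: sgn_if)
  ultimately show ?thesis by (metis DERIV_cong_ev)
qed

lemma isCont_rpow:
  assumes "x \<noteq> 0"
  shows "isCont (\<lambda>x. rpow x b) x"
proof -
  \<comment> \<open>The sign of \<open>rpow y b\<close> depends on \<open>y\<close> only through the
    sign of \<open>y\<close>, so it is this constant for all \<open>y\<close> near
    \<open>x\<close>.\<close>
  define c :: real where "c = (if x < 0 \<and> \<not> even_fraction b then - 1 else 1)"
  have "isCont (\<lambda>y. c * \<bar>y\<bar> powr b) x"
    using assms by (intro continuous_intros) auto
  moreover have "eventually (\<lambda>y. rpow y b = c * \<bar>y\<bar> powr b) (nhds x)"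
    using eventually_sgn_eq[OF assms]
  proof eventually_elim
    case (elim y)
    then have "y \<noteq> 0" "y < 0 \<longleftrightarrow> x < 0" using assms by (auto simp: sgn_if split: if_splits)
    then show ?case by (cases "y < 0") (auto simp: c_def rpow_neg)
  qed
  ultimately show ?thesis using isCont_cong[of "\<lambda>x. rpow x b" "\<lambda>y. c * \<bar>y\<bar> powr b" x] by simp
qed

subsection \<open>The generalized derivative and linear equations\<close>

text \<open>All three cases are one filter: the limit over the steps \<open>h\<close> for which
  \<open>t - h * c\<close> stays in \<open>U\<close>. As \<open>c > 0\<close>, at a minimum these
  are near \<open>0\<close> the steps \<open>h \<le> 0\<close>, at a maximum the steps
  \<open>h \<ge> 0\<close>.\<close>

lemma gen_deriv_filter_eq:
  fixes t c :: real
  assumes "is_interval U" "interior U \<noteq> {}" "t \<in> U" "0 < c"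
  shows "(if \<forall>s\<in>U. t \<le> s then at_left 0 else if \<forall>s\<in>U. s \<le> t then at_right 0 else at 0)
    = at 0 within {h. t - h * c \<in> U}"
proof -
  obtain x e where e: "e > 0" "ball x e \<subseteq> U"
    using assms(2) by (auto simp: mem_interior)
  have mem: "r \<in> U" if "l \<in> U" "s \<in> U" "l \<le> r" "r \<le> s" for l r s
    using assms(1) that by (meson mem_is_interval_1_I)
  \<comment> \<open>Two distinct points of \<open>U\<close>, so that \<open>t\<close> cannot be both
    its minimum and its maximum.\<close>
  have two: "x - e/2 \<in> U" "x + e/2 \<in> U" using e by (auto simp: dist_real_def)
  \<comment> \<open>Agreement near \<open>0\<close> is enough: the window from \<open>l\<close> to
    \<open>s\<close> around \<open>t\<close>, pulled back along \<open>t - h * c\<close>, is a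
    neighborhood of \<open>0\<close>.\<close>
  have key: "at 0 within A = at 0 within {h. t - h * c \<in> U}"
    if ls: "l < t" "t < s" and A: "\<And>h. l < t - h * c \<Longrightarrow> t - h * c < s \<Longrightarrow> h \<noteq> 0 \<Longrightarrow> h \<in> A \<longleftrightarrow> t - h * c \<in> U"
    for l s A
  proof (rule at_within_nhd[of _ "{(t - s) / c<..<(t - l) / c}"])
    show "A \<inter> {(t - s) / c<..<(t - l) / c} - {0} = {h. t - h * c \<in> U} \<inter> {(t - s) / c<..<(t - l) / c} - {0}"
      using A assms(4) by (auto simp: field_simps)
  qed (use ls assms(4) in \<open>auto simp: field_simps\<close>)
  have sign: "t - h * c \<le> t \<longleftrightarrow> 0 \<le> h" "t \<le> t - h * c \<longleftrightarrow> h \<le> 0" for h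
    using assms(4) by (auto simp: zero_le_mult_iff mult_le_0_iff)
  show ?thesis
  proof (cases "\<forall>s\<in>U. t \<le> s")
    case True
    then have "t < x + e/2" using two e by force
    then have "at 0 within {..<0} = at 0 within {h. t - h * c \<in> U}"
    \<comment> \<open>The bound \<open>t - 1\<close> is arbitrary, as \<open>U\<close> has no points
      to the left of \<open>t\<close>.\<close>
    proof (intro key[of "t - 1" "x + e/2"])
      fix h :: real assume "t - h * c < x + e/2" "h \<noteq> 0"
      then show "h \<in> {..<0} \<longleftrightarrow> t - h * c \<in> U"
        using True mem[OF assms(3) two(2), of "t - h * c"] sign(2)[of h] by force
    qed simp_all
    then show ?thesis using True by simp
  next
    case False
    then obtain l where l: "l \<in> U" "l < t" by force
    show ?thesis
    proof (cases "\<forall>s\<in>U. s \<le> t")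
      case True
      have "at 0 within {0<..} = at 0 within {h. t - h * c \<in> U}"
      proof (intro key[of l "t + 1"])
        fix h :: real assume "l < t - h * c" "h \<noteq> 0"
        then show "h \<in> {0<..} \<longleftrightarrow> t - h * c \<in> U"
          using True mem[OF l(1) assms(3), of "t - h * c"] sign(1)[of h] by force
      qed (use l in simp_all)
      then show ?thesis using True by (subst if_not_P[OF False]) simp
    next
      case f2: False
      then obtain s where s: "s \<in> U" "t < s" by force
      have "at 0 within UNIV = at 0 within {h. t - h * c \<in> U}"
      proof (intro key[of l s])
        fix h :: real assume "l < t - h * c" "t - h * c < s"
        then show "h \<in> UNIV \<longleftrightarrow> t - h * c \<in> U"
          using mem[OF l(1) s(1), of "t - h * c"] by simp
      qed (use l s in simp_all)
      then show ?thesis by (simp only: if_not_P[OF f2] if_not_P[OF False])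
    qed
  qed
qed

text \<open>The substitution \<open>y = t - h * c\<close> with \<open>c = T t \<alpha>\<close> makes
  one difference quotient \<open>c\<close> times the other. It and its inverse respect the two
  punctured filters, so either limit gives the other.\<close>

lemma has_gen_deriv_iff:
  assumes "is_interval U" "interior U \<noteq> {}" "t \<in> U" "0 < T t \<alpha>"
  shows "has_gen_deriv T \<alpha> U f D t \<longleftrightarrow> (f has_real_derivative D / T t \<alpha>) (at t within U)"
proof -
  define c where "c = T t \<alpha>"
  define S where "S = {h. t - h * c \<in> U}"
  have c: "c > 0" using assms(4) by (simp add: c_def)
  have F: "has_gen_deriv T \<alpha> U f D t \<longleftrightarrow> ((\<lambda>h. (f t - f (t - h * c)) / h) \<longlongrightarrow> D) (at 0 within S)"
    unfolding has_gen_deriv_def using gen_deriv_filter_eq[OF assms] by (simp add: c_def S_def)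
  have *: "filterlim (\<lambda>h. t - h * c) (at t within U) (at 0 within S)"
    unfolding filterlim_at
  proof
    have "((\<lambda>h. t - h * c) \<longlongrightarrow> t - 0 * c) (at 0 within S)" by (intro tendsto_intros)
    then show "((\<lambda>h. t - h * c) \<longlongrightarrow> t) (at 0 within S)" by simp
  qed (use c in \<open>auto simp: eventually_at_filter S_def\<close>)
  have **: "filterlim (\<lambda>y. (t - y) / c) (at 0 within S) (at t within U)"
    unfolding filterlim_at
  proof
    have "((\<lambda>y. (t - y) / c) \<longlongrightarrow> (t - t) / c) (at t within U)" using c by (intro tendsto_intros) auto
    then show "((\<lambda>y. (t - y) / c) \<longlongrightarrow> 0) (at t within U)" by simp
  qed (use c in \<open>auto simp: eventually_at_filter S_def\<close>)
  show ?thesis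
  proof
    assume "has_gen_deriv T \<alpha> U f D t"
    then have "((\<lambda>y. (f t - f (t - (t - y) / c * c)) / ((t - y) / c) / c) \<longlongrightarrow> D / c) (at t within U)"
      unfolding F using c by (intro tendsto_divide tendsto_const filterlim_compose[OF _ **]) auto
    moreover have "(f t - f (t - (t - y) / c * c)) / ((t - y) / c) / c = (f y - f t) / (y - t)" for y
      using c minus_divide_divide[of "f y - f t" "y - t"] by simp
    ultimately show "(f has_real_derivative D / T t \<alpha>) (at t within U)"
      by (simp add: has_field_derivative_iff c_def)
  next
    assume "(f has_real_derivative D / T t \<alpha>) (at t within U)"
    then have "((\<lambda>y. (f y - f t) / (y - t)) \<longlongrightarrow> D / c) (at t within U)"
      by (simp add: has_field_derivative_iff c_def)
    then have "((\<lambda>h. (f (t - h * c) - f t) / (t - h * c - t) * c) \<longlongrightarrow> D / c * c) (at 0 within S)"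
      by (intro tendsto_mult tendsto_const filterlim_compose[OF _ *])
    \<comment> \<open>At \<open>h = 0\<close> both sides are \<open>0\<close> by the convention on
      division by zero.\<close>
    moreover have "(f (t - h * c) - f t) / (t - h * c - t) * c = (f t - f (t - h * c)) / h" for h
      using c by (cases "h = 0") (auto simp: field_simps)
    ultimately show "has_gen_deriv T \<alpha> U f D t" unfolding F using c by simp
  qed
qed

text \<open>The fundamental theorem of calculus is applied on a compact interval
  \<open>{l..r}\<close> inside \<open>U\<close> that contains \<open>a\<close> and coincides with
  \<open>U\<close> near \<open>t\<close>.\<close>

lemma has_real_derivative_interval_integral:
  fixes g :: "real \<Rightarrow> real"
  assumes U: "is_interval U" and g: "continuous_on U g" and a: "a \<in> U" and t: "t \<in> U"
  shows "((\<lambda>u. LBINT w=a..u. g w) has_real_derivative g t) (at t within U)"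
proof -
  have mem: "r \<in> U" if "l \<in> U" "s \<in> U" "l \<le> r" "r \<le> s" for l r s
    using U that by (meson mem_is_interval_1_I)
  \<comment> \<open>A point strictly to the left of \<open>t\<close>, or \<open>t\<close> itself if
    it is the minimum of \<open>U\<close>; \<open>r0\<close> is the counterpart on the
    right.\<close>
  obtain l0 where l0: "l0 \<in> U" "l0 \<le> t" "l0 < t \<or> (\<forall>s\<in>U. t \<le> s)" using t by (metis le_less not_le)
  obtain r0 where r0: "r0 \<in> U" "t \<le> r0" "t < r0 \<or> (\<forall>s\<in>U. s \<le> t)" using t by (metis le_less not_le)
  define l r where "l = min l0 a" and "r = max r0 a"
  have lr: "l \<in> U" "r \<in> U" "l \<le> a" "a \<le> r" "l \<le> t" "t \<le> r"
    using l0 r0 a by (auto simp: l_def r_def min_def max_def)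
  have sub: "{l..r} \<subseteq> U" using mem[OF lr(1,2)] by auto
  have "((\<lambda>u. LBINT w=a..u. g w) has_real_derivative g t) (at t within {l..r})"
    unfolding has_real_derivative_iff_has_vector_derivative
    by (rule interval_integral_FTC2[OF lr(3,4) continuous_on_subset[OF g sub] lr(5,6)])
  moreover define A where "A = (if l0 < t then {l0<..} else UNIV) \<inter> (if t < r0 then {..<r0} else UNIV)"
  have "at t within U = at t within {l..r}"
  proof (rule at_within_nhd[of t A])
    show "U \<inter> A - {t} = {l..r} \<inter> A - {t}"
    proof (intro set_eqI iffI)
      fix s assume s: "s \<in> U \<inter> A - {t}"
      then have "l0 \<le> s" "s \<le> r0" using l0(2,3) r0(2,3) by (auto simp: A_def split: if_splits)
      then show "s \<in> {l..r} \<inter> A - {t}" using s by (auto simp: l_def r_def)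
    qed (use sub in auto)
  qed (auto simp: A_def)
  ultimately show ?thesis by simp
qed

text \<open>Integrating factor: with \<open>K' = k\<close>, the function
  \<open>z * exp (- K)\<close> has derivative zero, so it keeps the value \<open>0\<close> that it
  has at \<open>t0\<close>.\<close>

lemma homogeneous_linear_ode_zero:
  fixes z k :: "real \<Rightarrow> real"
  assumes U: "is_interval U" and k: "continuous_on U k" and t0: "t0 \<in> U" "z t0 = 0"
    and z: "\<And>t. t \<in> U \<Longrightarrow> (z has_real_derivative k t * z t) (at t within U)"
    and t: "t \<in> U"
  shows "z t = 0"
proof -
  define K where "K u = (LBINT w=t0..u. k w)" for u :: real
  have "((\<lambda>t. z t * exp (- K t)) has_real_derivative 0) (at t within U)" if "t \<in> U" for t
  proof -
    have "(K has_real_derivative k t) (at t within U)"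
      unfolding K_def using has_real_derivative_interval_integral[OF U k t0(1) that] .
    then show ?thesis by (auto intro!: derivative_eq_intros z that)
  qed
  then obtain c where c: "\<forall>t\<in>U. z t * exp (- K t) = c"
    using has_field_derivative_zero_constant U is_interval_convex by blast
  then have "c = 0" using t0 by force
  then show ?thesis using c t by auto
qed

section \<open>Powers near the base zero\<close>

lemma has_real_derivative_rpow_0:
  assumes "1 < b"
  shows "((\<lambda>x. rpow x b) has_real_derivative 0) (at 0)"
proof -
  have "((\<lambda>x::real. \<bar>x\<bar> powr (b - 1)) \<longlongrightarrow> \<bar>0\<bar> powr (b - 1)) (at 0)"
    using assms by (intro tendsto_powr' tendsto_intros) auto
  then have lim: "((\<lambda>x::real. \<bar>x\<bar> powr (b - 1)) \<longlongrightarrow> 0) (at 0)" by simp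
  \<comment> \<open>Only absolute values enter, so the sign given to powers of negative bases does
    not affect the bound.\<close>
  have "\<bar>(rpow x b - rpow 0 b) / (x - 0)\<bar> \<le> \<bar>x\<bar> powr (b - 1)" if "x \<noteq> 0" for x
    using that assms by (simp add: rpow_zero abs_rpow abs_divide powr_diff)
  then have "eventually (\<lambda>x. norm ((rpow x b - rpow 0 b) / (x - 0)) \<le> \<bar>x\<bar> powr (b - 1)) (at 0)"
    by (simp add: eventually_at_filter)
  then have "((\<lambda>x. (rpow x b - rpow 0 b) / (x - 0)) \<longlongrightarrow> 0) (at 0)"
    using lim by (rule Lim_null_comparison)
  then show ?thesis by (simp add: has_field_derivative_iff)
qed

text \<open>The limit at \<open>0\<close> is the derivative of the power there, which is
  \<open>0\<close> and thus equals the conventional value \<open>0 / 0\<close>.\<close>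

lemma continuous_rpow_divide:
  assumes "1 < b"
  shows "continuous_on UNIV (\<lambda>x. rpow x b / x)"
proof -
  have "isCont (\<lambda>x. rpow x b / x) x" for x
  proof (cases "x = 0")
    case True
    show ?thesis
      using has_real_derivative_rpow_0[OF assms] assms True
      by (simp add: isCont_def has_field_derivative_iff rpow_zero)
  qed (intro continuous_intros isCont_rpow)
  then show ?thesis by (simp add: continuous_on_eq_continuous_at)
qed

text \<open>Intermediate value theorem: the image is an interval that misses
  \<open>0\<close>.\<close>

lemma connected_nonzero_sgn_eq:
  fixes f :: "'a::topological_space \<Rightarrow> real"
  assumes "connected S" "continuous_on S f" "\<And>t. t \<in> S \<Longrightarrow> f t \<noteq> 0" "s \<in> S" "t \<in> S"
  shows "sgn (f t) = sgn (f s)"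
proof (rule ccontr)
  assume neq: "sgn (f t) \<noteq> sgn (f s)"
  have "is_interval (f ` S)" using assms(1,2) connected_continuous_image is_interval_connected_1 by blast
  moreover have "f s \<noteq> 0" "f t \<noteq> 0" using assms by auto
  then have "f s \<le> 0 \<and> 0 \<le> f t \<or> f t \<le> 0 \<and> 0 \<le> f s" using neq by (auto simp: sgn_if split: if_splits)
  ultimately have "0 \<in> f ` S" using assms(4,5) by (meson image_eqI mem_is_interval_1_I)
  then show False using assms(3) by auto
qed

subsection \<open>The Bernoulli equation\<close>

text \<open>Chain rule for \<open>y = u ^ b\<close> with \<open>b = 1 / (1 - n)\<close>. As
  \<open>b * n = b - 1\<close>, the factor \<open>\<bar>u\<bar> powr (b - 1)\<close> of the
  derivative is both \<open>y ^ n\<close> and \<open>y / u\<close>.\<close>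

lemma bernoulli_substitution:
  assumes f: "(f has_real_derivative (1 - n) * (Q - P * f t) / c) (at t within U)"
    and nz: "f t \<noteq> 0" and odd: "f t < 0 \<Longrightarrow> odd_fraction (1 - n)" and n: "n \<noteq> 1"
  defines "y \<equiv> \<lambda>s. rpow (f s) (1 / (1 - n))"
  shows "(y has_real_derivative (Q * rpow (y t) n - P * y t) / c) (at t within U)"
proof -
  define b where "b = 1 / (1 - n)"
  have b: "b * (1 - n) = 1" "b * n = b - 1" using n by (auto simp: b_def field_simps)
  have odd_b: "odd_fraction b" if "f t < 0" using odd_fraction_inverse[OF odd[OF that]] by (simp add: b_def)
  have "(y has_real_derivative b * \<bar>f t\<bar> powr (b - 1) * ((1 - n) * (Q - P * f t) / c)) (at t within U)"
    unfolding y_def b_def[symmetric]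
    by (rule DERIV_chain2[OF has_real_derivative_rpow f]) (use nz odd_b in auto)
  moreover have "sgn (y t) = sgn (f t)"
    unfolding y_def b_def[symmetric] using nz odd_b by (rule sgn_rpow_odd_fraction)
  then have "y t \<noteq> 0" "y t < 0 \<longleftrightarrow> f t < 0" using nz by (auto simp: sgn_if split: if_splits)
  \<comment> \<open>For negative \<open>y t\<close> the exponent \<open>n\<close> is an even
    fraction, so the sign is lost, just as in the derivative of the power.\<close>
  then have "rpow (y t) n = \<bar>y t\<bar> powr n"
    using odd_fraction_one_minus[OF odd] by (intro rpow_even_fraction) auto
  then have "rpow (y t) n = \<bar>f t\<bar> powr (b - 1)"
    using nz b by (simp add: y_def b_def[symmetric] abs_rpow powr_powr)
  moreover have "y t = f t * \<bar>f t\<bar> powr (b - 1)"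
  proof -
    have "y t = sgn (f t) * \<bar>f t\<bar> powr (1 + (b - 1))"
      unfolding y_def b_def[symmetric] using nz odd_b by (simp add: rpow_odd_fraction)
    also have "\<dots> = f t * \<bar>f t\<bar> powr (b - 1)"
      unfolding powr_add using nz by (simp flip: mult.assoc add: sgn_mult_abs)
    finally show ?thesis .
  qed
  moreover have "b * F * ((1 - n) * (Q - P * x) / c) = (Q * F - P * (x * F)) / c" for F x
  proof -
    have "b * F * ((1 - n) * (Q - P * x) / c) = b * (1 - n) * (F * (Q - P * x) / c)" by simp
    then show ?thesis unfolding b by (simp add: algebra_simps)
  qed
  ultimately show ?thesis by (metis (no_types))
qed

text \<open>The outer derivative \<open>(1 - n) * \<bar>z\<bar> powr (- n)\<close> cancels
  \<open>z ^ n\<close> and turns \<open>z\<close> into \<open>z ^ (1 - n)\<close>, which makes the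
  equation linear.\<close>

lemma bernoulli_substitution_converse:
  assumes z: "(z has_real_derivative (Q * rpow (z t) n - P * z t) / c) (at t within U)"
    and nz: "z t \<noteq> 0" and odd: "z t < 0 \<Longrightarrow> odd_fraction (1 - n)"
  defines "w \<equiv> \<lambda>s. rpow (z s) (1 - n)"
  shows "(w has_real_derivative (1 - n) * (Q - P * w t) / c) (at t within U)"
proof -
  have "(w has_real_derivative
      (1 - n) * \<bar>z t\<bar> powr (1 - n - 1) * ((Q * rpow (z t) n - P * z t) / c)) (at t within U)"
    unfolding w_def by (rule DERIV_chain2[OF has_real_derivative_rpow z]) (use nz odd in auto)
  moreover have 1: "rpow (z t) n = \<bar>z t\<bar> powr n"
    using nz odd odd_fraction_one_minus by (simp add: rpow_even_fraction)
  have 2: "\<bar>z t\<bar> powr (- n) * \<bar>z t\<bar> powr n = 1"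
    using nz by (simp flip: powr_add)
  have 3: "\<bar>z t\<bar> powr (- n) * z t = w t"
  proof -
    have "w t = sgn (z t) * \<bar>z t\<bar> powr (1 + - n)"
      unfolding w_def using nz odd by (simp add: rpow_odd_fraction)
    also have "\<dots> = \<bar>z t\<bar> powr (- n) * z t"
      unfolding powr_add using nz by (simp flip: mult.assoc add: sgn_mult_abs)
    finally show ?thesis by simp
  qed
  have "(1 - n) * \<bar>z t\<bar> powr (1 - n - 1) * ((Q * rpow (z t) n - P * z t) / c)
      = (1 - n) * (Q * (\<bar>z t\<bar> powr (- n) * \<bar>z t\<bar> powr n) - P * (\<bar>z t\<bar> powr (- n) * z t)) / c"
    unfolding 1 by (simp add: right_diff_distrib ac_simps)
  then have "(1 - n) * \<bar>z t\<bar> powr (1 - n - 1) * ((Q * rpow (z t) n - P * z t) / c)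
      = (1 - n) * (Q - P * w t) / c"
    unfolding 2 3 by simp
  ultimately show ?thesis by (rule DERIV_cong)
qed

section \<open>Where the substitution can be inverted\<close>

lemma bernoulli_root_definedI:
  assumes "u \<noteq> 0" "u < 0 \<Longrightarrow> odd_fraction (1 - n)" "n \<noteq> 1"
  shows "bernoulli_root_defined n u"
proof -
  define y where "y = rpow u (1 / (1 - n))"
  have odd: "odd_fraction (1 / (1 - n))" if "u < 0" by (rule odd_fraction_inverse[OF assms(2)[OF that]])
  have "rpow_defined u (1 / (1 - n))" using assms(1) odd by (auto simp: rpow_defined_iff)
  moreover have "sgn y = sgn u" unfolding y_def using assms(1) odd by (rule sgn_rpow_odd_fraction)
  then have "y \<noteq> 0" "y < 0 \<longleftrightarrow> u < 0" using assms(1) by (auto simp: sgn_if split: if_splits)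
  then have "rpow_defined y n" "rpow_defined y (1 - n)"
    using assms(2) odd_fraction_one_minus by (auto simp: rpow_defined_iff)
  moreover have "rpow y (1 - n) = u"
    using rpow_rpow_inverse[of u "1 / (1 - n)"] odd assms(1,3) by (simp add: y_def)
  ultimately show ?thesis by (simp add: bernoulli_root_defined_def Let_def y_def)
qed

text \<open>For an even fraction \<open>1 / (1 - n)\<close> the root would be positive, and so would
  its power with exponent \<open>1 - n\<close>, which has to be the negative
  \<open>u\<close>.\<close>

lemma bernoulli_root_defined_neg:
  assumes "bernoulli_root_defined n u" "u < 0"
  shows "odd_fraction (1 - n)"
proof -
  have "\<not> even_fraction (1 / (1 - n))"
  proof
    assume "even_fraction (1 / (1 - n))"
    then have "rpow u (1 / (1 - n)) > 0" using assms(2) by (simp add: rpow_neg)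
    then have "rpow (rpow u (1 / (1 - n))) (1 - n) > 0" by simp
    then show False using assms by (simp add: bernoulli_root_defined_def Let_def)
  qed
  then have "odd_fraction (1 / (1 - n))"
    using assms by (auto simp: bernoulli_root_defined_def rpow_defined_iff)
  from odd_fraction_inverse[OF this] show ?thesis by simp
qed

text \<open>For \<open>n > 1\<close> the root of \<open>0\<close> has a negative exponent; for
  \<open>n < 0\<close> the root is \<open>0\<close> and its power with exponent \<open>n\<close> is
  undefined.\<close>

lemma bernoulli_root_defined_zero:
  assumes "bernoulli_root_defined n 0" "n \<noteq> 1"
  shows "0 \<le> n" "n < 1"
  using assms by (auto simp: bernoulli_root_defined_def Let_def rpow_defined_iff rpow_zero)

section \<open>The linear equation of the bracket\<close>

locale bernoulli_equation =
  fixes T :: "real \<Rightarrow> real \<Rightarrow> real" and p q :: "real \<Rightarrow> real"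
    and I :: "real set" and a \<alpha> n :: real
  assumes interval: "is_interval I" and interior: "interior I \<noteq> {}" and a: "a \<in> I"
    and n: "n \<noteq> 1"
    and contT: "continuous_on I (\<lambda>t. T t \<alpha>)" and T_pos: "t \<in> I \<Longrightarrow> 0 < T t \<alpha>"
    and contp: "continuous_on I p" and contq: "continuous_on I q"
begin

abbreviation "bracket \<equiv> bernoulli_bracket T \<alpha> p q n a"
abbreviation "formula \<equiv> bernoulli_formula T \<alpha> p q n a"
abbreviation "const \<equiv> bernoulli_const T \<alpha> p q n a"
abbreviation "solution_on \<equiv> bernoulli_solution_on T \<alpha> p q n"
abbreviation "sol_dom \<equiv> bernoulli_ivp_dom T \<alpha> p q n I a"

lemma T_nonzero: "t \<in> I \<Longrightarrow> T t \<alpha> \<noteq> 0"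
  using T_pos by fastforce

lemma gen_int_deriv:
  assumes "continuous_on I f" "t \<in> I"
  shows "(gen_int T \<alpha> a f has_real_derivative f t / T t \<alpha>) (at t within I)"
  unfolding gen_int_def using T_nonzero
  by (intro has_real_derivative_interval_integral[OF interval _ a assms(2)] continuous_intros assms contT) auto

text \<open>Variation of constants: the derivative of the outer exponential gives the term with
  \<open>p\<close>, that of the inner integral the term with \<open>q\<close>, in which the two
  exponentials cancel.\<close>

lemma bracket_deriv:
  assumes t: "t \<in> I"
  shows "(bracket C has_real_derivative (1 - n) * (q t - p t * bracket C t) / T t \<alpha>) (at t within I)"
proof -
  define P where "P = gen_int T \<alpha> a p"
  have P: "(P has_real_derivative p t / T t \<alpha>) (at t within I)" if "t \<in> I" for t
    unfolding P_def by (rule gen_int_deriv[OF contp that])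
  have "continuous_on I P" using P by (rule DERIV_continuous_on)
  then have "continuous_on I (\<lambda>s. q s * exp ((1 - n) * P s))"
    by (intro continuous_intros contq)
  note Q = gen_int_deriv[OF this t]
  define R where "R = gen_int T \<alpha> a (\<lambda>s. q s * exp ((1 - n) * P s))"
  have eq: "bracket C = (\<lambda>t. exp (- (1 - n) * P t) * ((1 - n) * R t + C))"
    by (rule ext) (simp add: bernoulli_bracket_def P_def R_def)
  have e: "exp (- (1 - n) * P t) * exp ((1 - n) * P t) = 1"
    by (simp add: algebra_simps flip: exp_add)
  have "(bracket C has_real_derivative
      exp (- (1 - n) * P t) * (- (1 - n) * (p t / T t \<alpha>)) * ((1 - n) * R t + C)
      + (1 - n) * (q t * exp ((1 - n) * P t) / T t \<alpha>) * exp (- (1 - n) * P t)) (at t within I)"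
    unfolding eq by (auto intro!: derivative_eq_intros P[OF t] Q[folded R_def] simp: ac_simps)
  \<comment> \<open>Stated for arbitrary reals, so that the product \<open>E * F\<close> of the
    exponentials stays intact until it is replaced by \<open>1\<close>.\<close>
  moreover have "E * (- m * (P / c)) * X + m * (Q * F / c) * E = m * (Q * (E * F) - P * (E * X)) / c"
    for E F X P Q m c :: real
    by (simp add: divide_inverse algebra_simps)
  then have "exp (- (1 - n) * P t) * (- (1 - n) * (p t / T t \<alpha>)) * ((1 - n) * R t + C)
      + (1 - n) * (q t * exp ((1 - n) * P t) / T t \<alpha>) * exp (- (1 - n) * P t)
      = (1 - n) * (q t * (exp (- (1 - n) * P t) * exp ((1 - n) * P t)) - p t * bracket C t) / T t \<alpha>"
    unfolding eq .
  ultimately show ?thesis unfolding e by simp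
qed

lemma continuous_bracket: "continuous_on I (bracket C)"
  using bracket_deriv by (rule DERIV_continuous_on)

text \<open>The difference of two solutions of the linear equation solves the homogeneous one and
  vanishes at \<open>t0\<close>.\<close>

lemma bracket_unique:
  assumes U: "is_interval U" "U \<subseteq> I" and t0: "t0 \<in> U" "w t0 = bracket C t0"
    and w: "\<And>t. t \<in> U \<Longrightarrow> (w has_real_derivative (1 - n) * (q t - p t * w t) / T t \<alpha>) (at t within U)"
    and t: "t \<in> U"
  shows "w t = bracket C t"
proof -
  have "w t - bracket C t = 0"
  proof (rule homogeneous_linear_ode_zero[OF U(1) _ t0(1) _ _ t])
    show "continuous_on U (\<lambda>t. - (1 - n) * p t / T t \<alpha>)"
      using T_nonzero U by (intro continuous_intros continuous_on_subset[OF contp] continuous_on_subset[OF contT]) auto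
    fix t assume t: "t \<in> U"
    have "((\<lambda>t. w t - bracket C t) has_real_derivative
      (1 - n) * (q t - p t * w t) / T t \<alpha> - (1 - n) * (q t - p t * bracket C t) / T t \<alpha>) (at t within U)"
      using t U by (intro DERIV_diff w DERIV_subset[OF bracket_deriv]) auto
    then show "((\<lambda>t. w t - bracket C t) has_real_derivative
      - (1 - n) * p t / T t \<alpha> * (w t - bracket C t)) (at t within U)"
      by (rule DERIV_cong) (simp flip: diff_divide_distrib add: algebra_simps)
  qed (use t0 in simp)
  then show ?thesis by simp
qed

section \<open>Solutions given by the formula\<close>

lemma solution_on_iff:
  assumes "subinterval U I"
  shows "solution_on U y \<longleftrightarrow> (\<forall>t\<in>U. rpow_defined (y t) n \<and>
    (y has_real_derivative (q t * rpow (y t) n - p t * y t) / T t \<alpha>) (at t within U))"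
proof -
  have "(\<exists>D. has_gen_deriv T \<alpha> U y D t \<and> D + p t * y t = q t * rpow (y t) n) \<longleftrightarrow>
      (y has_real_derivative (q t * rpow (y t) n - p t * y t) / T t \<alpha>) (at t within U)" if "t \<in> U" for t
  proof -
    have "has_gen_deriv T \<alpha> U y D t \<longleftrightarrow> (y has_real_derivative D / T t \<alpha>) (at t within U)" for D
      using assms that T_pos by (intro has_gen_deriv_iff) (auto simp: subinterval_def)
    moreover have "D + p t * y t = q t * rpow (y t) n \<longleftrightarrow> D = q t * rpow (y t) n - p t * y t" for D
      by auto
    ultimately show ?thesis by simp
  qed
  then show ?thesis by (auto simp: bernoulli_solution_on_def)
qed

lemma solution_on_deriv:
  assumes "subinterval U I" "solution_on U y" "t \<in> U"
  shows "(y has_real_derivative (q t * rpow (y t) n - p t * y t) / T t \<alpha>) (at t within U)"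
  using iffD1[OF solution_on_iff[OF assms(1)] assms(2)] assms(3) by blast

lemma continuous_solution:
  "subinterval U I \<Longrightarrow> solution_on U y \<Longrightarrow> continuous_on U y"
  by (rule DERIV_continuous_on[OF solution_on_deriv])

text \<open>The substitution settles the points where the bracket is nonzero. A zero of the bracket
  forces \<open>0 \<le> n < 1\<close>: for \<open>n = 0\<close> the formula is the bracket itself,
  and for \<open>0 < n < 1\<close> the exponent exceeds \<open>1\<close>, so both sides of the
  equation vanish.\<close>

lemma formula_solution:
  assumes U: "subinterval U I" and root: "\<And>t. t \<in> U \<Longrightarrow> bernoulli_root_defined n (bracket C t)"
  shows "solution_on U (formula C)"
  unfolding solution_on_iff[OF U]
proof (intro ballI conjI)
  fix t assume t: "t \<in> U"
  have sub: "U \<subseteq> I" using U by (simp add: subinterval_def)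
  show "rpow_defined (formula C t) n"
    using root[OF t] by (simp add: bernoulli_root_defined_def Let_def bernoulli_formula_def)
  have d: "(bracket C has_real_derivative (1 - n) * (q t - p t * bracket C t) / T t \<alpha>) (at t within U)"
    using bracket_deriv t sub DERIV_subset by blast
  have eq: "formula C = (\<lambda>s. rpow (bracket C s) (1 / (1 - n)))"
    by (rule ext) (simp add: bernoulli_formula_def)
  show "(formula C has_real_derivative
    (q t * rpow (formula C t) n - p t * formula C t) / T t \<alpha>) (at t within U)"
  proof (cases "bracket C t = 0")
    case False
    then show ?thesis
      unfolding eq using bernoulli_root_defined_neg[OF root[OF t]]
      by (intro bernoulli_substitution[OF d] n) auto
  next
    case True
    then have n01: "0 \<le> n" "n < 1" using bernoulli_root_defined_zero[OF _ n] root[OF t] by metis+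
    show ?thesis
    proof (cases "n = 0")
      case True
      then show ?thesis using d \<open>bracket C t = 0\<close> unfolding eq by (simp add: rpow_zero rpow_one)
    next
      case False
      then have "1 < 1 / (1 - n)" using n01 by simp
      then have "((\<lambda>x. rpow x (1 / (1 - n))) has_real_derivative 0) (at (bracket C t))"
        using True by (simp only: has_real_derivative_rpow_0)
      from DERIV_chain2[OF this d] show ?thesis
        unfolding eq using True False n01 by (simp add: rpow_zero)
    qed
  qed
qed

section \<open>Initial values and uniqueness\<close>

lemma bracket_const: "bracket (const t0 y0) t0 = rpow y0 (1 - n)"
proof -
  have "bracket (const t0 y0) t0
      = rpow y0 (1 - n) * (exp (- (1 - n) * gen_int T \<alpha> a p t0) * exp ((1 - n) * gen_int T \<alpha> a p t0))"
    by (simp add: bernoulli_bracket_def bernoulli_const_def)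
  also have "exp (- (1 - n) * gen_int T \<alpha> a p t0) * exp ((1 - n) * gen_int T \<alpha> a p t0) = 1"
    by (simp add: algebra_simps flip: exp_add)
  finally show ?thesis by simp
qed

text \<open>Uniqueness carried over from the linear equation. The base point \<open>t1\<close> is
  arbitrary, so that agreement can be continued from any point already reached.\<close>

lemma nonzero_solution_bracket:
  assumes U: "is_interval U" "U \<subseteq> I"
    and z: "\<And>t. t \<in> U \<Longrightarrow> (z has_real_derivative (q t * rpow (z t) n - p t * z t) / T t \<alpha>) (at t within U)"
    and nz: "\<And>t. t \<in> U \<Longrightarrow> z t \<noteq> 0" and odd: "\<And>t. t \<in> U \<Longrightarrow> z t < 0 \<Longrightarrow> odd_fraction (1 - n)"
    and t1: "t1 \<in> U" "rpow (z t1) (1 - n) = bracket C t1" and t: "t \<in> U"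
  shows "z t = formula C t"
proof -
  have "rpow (z t) (1 - n) = bracket C t"
    by (rule bracket_unique[OF U t1 bernoulli_substitution_converse[OF z nz odd] t])
  moreover have "rpow (rpow (z t) (1 - n)) (1 / (1 - n)) = z t"
    using rpow_rpow_inverse[OF nz odd] t n by simp
  ultimately show ?thesis by (simp add: bernoulli_formula_def)
qed

text \<open>
  For \<open>n > 1\<close> the quotient \<open>y ^ n / y\<close> extends continuously by \<open>0 / 0 = 0\<close>, so a solution solves a
  homogeneous linear equation whose continuous coefficient depends on the solution itself.
\<close>

lemma zero_solution:
  assumes J: "subinterval J I" and z: "solution_on J z" and n1: "1 < n"
    and t0: "t0 \<in> J" "z t0 = 0" and t: "t \<in> J"
  shows "z t = 0"
proof (rule homogeneous_linear_ode_zero[where U = J and ?t0.0 = t0 and z = z and t = t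
      and k = "\<lambda>t. (q t * (rpow (z t) n / z t) - p t) / T t \<alpha>"])
  show "t0 \<in> J" "z t0 = 0" "t \<in> J" by fact+
  have sub: "J \<subseteq> I" using J by (simp add: subinterval_def)
  show "is_interval J" using J by (simp add: subinterval_def)
  have "continuous_on J (\<lambda>t. rpow (z t) n / z t)"
    using continuous_on_compose2[OF continuous_rpow_divide[OF n1] continuous_solution[OF J z]] by simp
  then show "continuous_on J (\<lambda>t. (q t * (rpow (z t) n / z t) - p t) / T t \<alpha>)"
    using T_nonzero sub
    by (intro continuous_on_divide[OF continuous_on_diff[OF continuous_on_mult]]
        continuous_on_subset[OF contq] continuous_on_subset[OF contp] continuous_on_subset[OF contT]) auto
  fix t assume "t \<in> J"
  from solution_on_deriv[OF J z this]
  show "(z has_real_derivative (q t * (rpow (z t) n / z t) - p t) / T t \<alpha> * z t) (at t within J)"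
  proof (rule DERIV_cong)
    have "rpow (z t) n = rpow (z t) n / z t * z t" using n1 by (cases "z t = 0") (auto simp: rpow_zero)
    then show "(q t * rpow (z t) n - p t * z t) / T t \<alpha>
        = (q t * (rpow (z t) n / z t) - p t) / T t \<alpha> * z t"
      by (metis left_diff_distrib mult.assoc times_divide_eq_left)
  qed
qed

text \<open>Without zeros \<open>z\<close> keeps the sign of \<open>z t0\<close>, so the parity
  condition at \<open>t0\<close> carries over to all of \<open>J\<close>.\<close>

lemma nonzero_solution_unique:
  assumes J: "subinterval J I" and z: "solution_on J z" and nz: "\<And>t. t \<in> J \<Longrightarrow> z t \<noteq> 0"
    and t0: "t0 \<in> J" and odd: "z t0 < 0 \<Longrightarrow> odd_fraction (1 - n)" and t: "t \<in> J"
  shows "z t = formula (const t0 (z t0)) t"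
proof (rule nonzero_solution_bracket[OF _ _ solution_on_deriv[OF J z] nz _ t0 bracket_const[symmetric] t])
  show "is_interval J" "J \<subseteq> I" using J by (auto simp: subinterval_def)
  fix s assume s: "s \<in> J" "z s < 0"
  have "sgn (z s) = sgn (z t0)"
    by (rule connected_nonzero_sgn_eq[OF _ continuous_solution[OF J z] nz t0 s(1)])
      (use J is_interval_connected in \<open>auto simp: subinterval_def\<close>)
  then have "z t0 < 0" using s by (auto simp: sgn_if split: if_splits)
  then show "odd_fraction (1 - n)" by (rule odd)
qed

lemma solution_unique_superlinear:
  assumes J: "subinterval J I" and z: "solution_on J z" and n1: "1 < n"
    and t0: "t0 \<in> J" and odd: "z t0 < 0 \<Longrightarrow> odd_fraction (1 - n)" and t: "t \<in> J"
  shows "z t = bernoulli_ivp T \<alpha> p q n a t0 (z t0) t"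
proof (cases "z t0 = 0")
  case True
  then show ?thesis using zero_solution[OF J z n1 t0 _ t] n1 by (simp add: bernoulli_ivp_def)
next
  case False
  \<comment> \<open>A zero at \<open>s\<close>, taken as the initial point, would force
    \<open>z t0 = 0\<close>.\<close>
  then have "z s \<noteq> 0" if "s \<in> J" for s using zero_solution[OF J z n1 that _ t0] by blast
  then show ?thesis
    using nonzero_solution_unique[OF J z _ t0 odd t] False by (simp add: bernoulli_ivp_def)
qed

section \<open>The domain of the solution\<close>

lemma ivp_domain:
  assumes t0: "t0 \<in> I" and y0: "y0 \<noteq> 0" and odd: "y0 < 0 \<longrightarrow> odd_fraction (1 - n)"
  defines "V \<equiv> sol_dom t0 y0" and "u \<equiv> bracket (const t0 y0)"
  shows "subinterval V I" "openin (top_of_set I) V" "t0 \<in> V"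
    and "t \<in> V \<Longrightarrow> sgn (u t) = sgn y0"
proof -
  define S where "S = {t \<in> I. u t \<noteq> 0}"
  have V: "V = connected_component_set S t0"
    using y0 by (simp add: V_def bernoulli_ivp_dom_def S_def u_def)
  \<comment> \<open>At \<open>t0\<close> the bracket is \<open>y0 ^ (1 - n)\<close>, and this power
    preserves the sign.\<close>
  have u0: "sgn (u t0) = sgn y0"
    unfolding u_def bracket_const using y0 odd[rule_format] by (rule sgn_rpow_odd_fraction)
  then have "t0 \<in> S" using t0 y0 by (auto simp: S_def sgn_zero_iff)
  then show "t0 \<in> V" by (simp add: V)
  have VS: "V \<subseteq> S" unfolding V by (rule connected_component_subset)
  have "openin (top_of_set I) (I \<inter> u -` (- {0}))"
    by (rule continuous_openin_preimage_gen) (auto simp: u_def continuous_bracket)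
  moreover have "I \<inter> u -` (- {0}) = S" by (auto simp: S_def)
  ultimately have SI: "openin (top_of_set I) S" by simp
  \<comment> \<open>Local connectedness passes to the relatively open set \<open>S\<close> and makes
    its components relatively open.\<close>
  have "locally connected I" by (intro convex_imp_locally_connected is_interval_convex interval)
  then have "locally connected S" using SI locally_open_subset by blast
  then have "openin (top_of_set S) V" unfolding V by (rule openin_connected_component_locally_connected)
  then show op: "openin (top_of_set I) V" using SI openin_trans by blast
  have conn: "connected V" unfolding V by (rule connected_connected_component)
  show "subinterval V I"
    unfolding subinterval_def
  proof (intro conjI)
    show "is_interval V" using conn is_interval_connected_1 by blast
    show "V \<subseteq> I" using VS by (auto simp: S_def)
    obtain W where W: "open W" "V = I \<inter> W" using op openin_open by blast
    \<comment> \<open>If \<open>t0\<close> is an endpoint of \<open>I\<close>, it is still a limit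
      of interior points of \<open>I\<close>, so the open set \<open>W\<close> contains some of
      them.\<close>
    have "closure (interior I) = closure I"
      by (rule convex_closure_interior[OF is_interval_convex[OF interval] interior])
    then have "t0 \<in> closure (interior I)" using t0 closure_subset by blast
    then have "W \<inter> interior I \<noteq> {}"
      using W \<open>t0 \<in> V\<close> open_Int_closure_eq_empty[of W "interior I"] by auto
    then show "interior V \<noteq> {}" unfolding W(2) interior_Int interior_open[OF W(1)] by auto
  qed
  show "sgn (u t) = sgn y0" if "t \<in> V"
  proof -
    have "continuous_on V u"
      unfolding u_def by (rule continuous_on_subset[OF continuous_bracket]) (use VS S_def in auto)
    then show ?thesis
      using connected_nonzero_sgn_eq[OF conn _ _ \<open>t0 \<in> V\<close> that, of u] VS u0 by (auto simp: S_def)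
  qed
qed

lemma ivp_initial:
  assumes "y0 \<noteq> 0" "y0 < 0 \<Longrightarrow> odd_fraction (1 - n)"
  shows "formula (const t0 y0) t0 = y0"
  using rpow_rpow_inverse[of y0 "1 - n"] assms n by (simp add: bernoulli_formula_def bracket_const)

lemma ivp_solution_dom:
  assumes t0: "t0 \<in> I" and y0: "y0 \<noteq> 0" and odd: "y0 < 0 \<Longrightarrow> odd_fraction (1 - n)"
  shows "bernoulli_ivp_solution_on T \<alpha> p q n t0 y0 (sol_dom t0 y0) (bernoulli_ivp T \<alpha> p q n a t0 y0)"
proof -
  have ivp: "bernoulli_ivp T \<alpha> p q n a t0 y0 = formula (const t0 y0)"
    using y0 by (auto simp: bernoulli_ivp_def)
  have "y0 < 0 \<longrightarrow> odd_fraction (1 - n)" using odd by blast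
  note dom = ivp_domain[OF t0 y0 this]
  have "solution_on (sol_dom t0 y0) (formula (const t0 y0))"
  proof (rule formula_solution[OF dom(1)])
    fix t assume "t \<in> sol_dom t0 y0"
    then have "sgn (bracket (const t0 y0) t) = sgn y0" by (rule dom(4))
    then have "bracket (const t0 y0) t \<noteq> 0" "bracket (const t0 y0) t < 0 \<longleftrightarrow> y0 < 0"
      using y0 by (auto simp: sgn_if split: if_splits)
    then show "bernoulli_root_defined n (bracket (const t0 y0) t)"
      using n odd by (intro bernoulli_root_definedI) auto
  qed
  then show ?thesis
    using dom(3) ivp_initial[OF y0 odd] by (simp add: bernoulli_ivp_solution_on_def ivp)
qed

text \<open>It is not known beforehand that \<open>z\<close> avoids \<open>0\<close> on the whole
  intersection, so the substitution is used only locally, and the set of agreement is shown to be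
  open and closed.\<close>

lemma positive_solution_unique_dom:
  assumes t0: "t0 \<in> I" and y0: "0 < y0" and J: "subinterval J I" and z: "solution_on J z"
    and z0: "t0 \<in> J" "z t0 = y0" and t: "t \<in> J \<inter> sol_dom t0 y0"
  shows "z t = formula (const t0 y0) t"
proof -
  define C where "C = const t0 y0"
  define W where "W = J \<inter> sol_dom t0 y0"
  have nn: "y0 \<noteq> 0" "y0 < 0 \<longrightarrow> odd_fraction (1 - n)" using y0 by auto
  note dom = ivp_domain[OF t0 nn]
  have W: "is_interval W" "W \<subseteq> I" "W \<subseteq> J" "t0 \<in> W"
    using J dom(1,3) z0 by (auto simp: W_def subinterval_def is_interval_Int)
  have u: "bracket C s > 0" if "s \<in> W" for s
    using dom(4)[of s] that y0 by (auto simp: W_def C_def sgn_if split: if_splits)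
  have zcont: "continuous_on W z" using continuous_solution[OF J z] W(3) continuous_on_subset by blast
  have fcont: "continuous_on W (formula C)"
  proof -
    have "continuous_on W (\<lambda>s. bracket C s powr (1 / (1 - n)))"
      using u by (intro continuous_intros continuous_on_subset[OF continuous_bracket] W(2)) fastforce
    then show ?thesis by (rule continuous_on_eq) (simp add: bernoulli_formula_def u)
  qed
  \<comment> \<open>Where \<open>z\<close> agrees with the positive formula it is positive nearby, hence agrees nearby.\<close>
  define A where "A = {s \<in> W. z s - formula C s = 0}"
  have "closedin (top_of_set W) A"
    unfolding A_def by (intro continuous_closedin_preimage_constant continuous_intros zcont fcont)
  moreover have "openin (top_of_set W) A"
    unfolding openin_euclidean_subtopology_iff
  proof (intro conjI ballI)
    fix s assume "s \<in> A"
    then have s: "s \<in> W" "z s = bracket C s powr (1 / (1 - n))"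
      by (auto simp: A_def bernoulli_formula_def u)
    then have "0 < z s" using u[of s] by simp
    \<comment> \<open>With \<open>z s\<close> itself as the tolerance, \<open>z\<close> remains
      positive within distance \<open>e\<close>.\<close>
    then obtain e where e: "0 < e" "\<And>r. r \<in> W \<Longrightarrow> dist r s < e \<Longrightarrow> dist (z r) (z s) < z s"
      using zcont s(1) unfolding continuous_on_iff by blast
    define B where "B = W \<inter> ball s e"
    have zB: "0 < z r" if "r \<in> B" for r
      using e(2)[of r] that by (auto simp: B_def dist_commute dist_real_def)
    have "z r = formula C r" if "r \<in> B" for r
    proof (rule nonzero_solution_bracket[where U = B and ?t1.0 = s])
      show "is_interval B" unfolding B_def by (intro is_interval_Int W is_interval_ball_real)
      show "B \<subseteq> I" "s \<in> B" "r \<in> B" using W s e that by (auto simp: B_def)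
      show "rpow (z s) (1 - n) = bracket C s" using s u[OF s(1)] n by (simp add: powr_powr)
      fix x assume x: "x \<in> B"
      show "z x \<noteq> 0" using zB x by fastforce
      show "odd_fraction (1 - n)" if "z x < 0" using zB[OF x] that by simp
      show "(z has_real_derivative (q x * rpow (z x) n - p x * z x) / T x \<alpha>) (at x within B)"
        by (rule DERIV_subset[OF solution_on_deriv[OF J z]]) (use x W in \<open>auto simp: B_def\<close>)
    qed
    then show "\<exists>e>0. \<forall>x'\<in>W. dist x' s < e \<longrightarrow> x' \<in> A"
      using e(1) by (intro exI[of _ e]) (auto simp: A_def B_def dist_commute)
  qed (auto simp: A_def)
  moreover have "t0 \<in> A" using W(4) z0 ivp_initial[OF nn(1) nn(2)[rule_format]] by (simp add: A_def C_def)
  moreover have "connected W" using W(1) is_interval_connected by blast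
  ultimately have "A = W" unfolding connected_clopen by blast
  then show ?thesis using t by (auto simp: A_def W_def C_def)
qed

text \<open>Agreement on all of \<open>J\<close>, even beyond the domain above. For
  \<open>0 < n < 1\<close> positivity is assumed, since a solution may reach \<open>0\<close> and
  then differ from the formula.\<close>

lemma positive_solution_unique:
  assumes y0: "0 < y0" and J: "subinterval J I" and z: "solution_on J z"
    and z0: "t0 \<in> J" "z t0 = y0" and cond: "n \<notin> {0<..<1} \<or> (\<forall>t\<in>J. 0 < z t)" and t: "t \<in> J"
  shows "z t = formula (const t0 y0) t"
proof -
  \<comment> \<open>The first case covers \<open>n < 0\<close>, where \<open>0 ^ n\<close> is
    undefined, and \<open>0 < n < 1\<close>, where positivity is assumed.\<close>
  consider "\<forall>t\<in>J. z t \<noteq> 0" | "n = 0" | "1 < n" using cond n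
  proof (cases "n < 0")
    case True
    have "z s \<noteq> 0" if "s \<in> J" for s
      using z that True solution_on_iff[OF J] by (fastforce simp: rpow_defined_iff)
    then show ?thesis using that by blast
  qed fastforce
  then show ?thesis
  proof cases
    case 1
    then show ?thesis using nonzero_solution_unique[OF J z _ z0(1) _ t] z0 y0 by auto
  next
    case 2
    \<comment> \<open>The zeroth power is \<open>1\<close> for every base, negative ones and
      \<open>0\<close> included, so for \<open>n = 0\<close> the equation is already the linear
      one.\<close>
    have "even_fraction 0" unfolding even_fraction_def by (intro exI[of _ 0] exI[of _ 1]) simp
    then have r0: "rpow x 0 = 1" for x
      by (cases "x = 0") (auto simp: rpow_zero rpow_even_fraction)
    have "z t = bracket (const t0 y0) t"
    proof (rule bracket_unique[OF _ _ z0(1) _ _ t])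
      show "z t0 = bracket (const t0 y0) t0" using z0 unfolding bracket_const by (simp add: 2 rpow_one)
      fix s assume "s \<in> J"
      from solution_on_deriv[OF J z this]
      show "(z has_real_derivative (1 - n) * (q s - p s * z s) / T s \<alpha>) (at s within J)"
        using 2 by (simp add: r0)
    qed (use J in \<open>auto simp: subinterval_def\<close>)
    then show ?thesis using 2 by (simp add: bernoulli_formula_def rpow_one)
  next
    case 3
    then show ?thesis
      using solution_unique_superlinear[OF J z 3 z0(1) _ t] z0 y0 by (simp add: bernoulli_ivp_def)
  qed
qed

end

theorem theorem22:
  fixes T :: "real \<Rightarrow> real \<Rightarrow> real" and p q :: "real \<Rightarrow> real"
    and I :: "real set" and a \<alpha> n :: real
  assumes "is_interval I" and "interior I \<noteq> {}" and "a \<in> I"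
    and "0 < \<alpha>" and "\<alpha> \<le> 1" and "n \<noteq> 1"
    and "continuous_on I (\<lambda>t. T t \<alpha>)" and "\<forall>t\<in>I. 0 < T t \<alpha>"
    and "continuous_on I p" and "continuous_on I q"
  shows
    "(\<forall>C U. subinterval U I \<and>
        (\<forall>t\<in>U. bernoulli_root_defined n (bernoulli_bracket T \<alpha> p q n a C t)) \<longrightarrow>
        bernoulli_solution_on T \<alpha> p q n U (bernoulli_formula T \<alpha> p q n a C)) \<and>
     (\<forall>t0\<in>I. \<forall>y0 U.
        rpow_defined y0 (1 - n) \<and> rpow_defined (rpow y0 (1 - n)) (1 / (1 - n)) \<and>
        rpow (rpow y0 (1 - n)) (1 / (1 - n)) = y0 \<and>
        subinterval U I \<and> t0 \<in> U \<and>
        (\<forall>t\<in>U. bernoulli_root_defined n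
           (bernoulli_bracket T \<alpha> p q n a (bernoulli_const T \<alpha> p q n a t0 y0) t)) \<longrightarrow>
        bernoulli_solution_on T \<alpha> p q n U (bernoulli_ivp T \<alpha> p q n a t0 y0) \<and>
        bernoulli_ivp T \<alpha> p q n a t0 y0 t0 = y0) \<and>
     (\<forall>t0\<in>I. \<forall>y0>0.
        let y = bernoulli_ivp T \<alpha> p q n a t0 y0; V = bernoulli_ivp_dom T \<alpha> p q n I a t0 y0 in
        subinterval V I \<and> openin (top_of_set I) V \<and>
        bernoulli_ivp_solution_on T \<alpha> p q n t0 y0 V y \<and>
        (\<forall>J z. subinterval J I \<and> bernoulli_ivp_solution_on T \<alpha> p q n t0 y0 J z \<longrightarrow>
           (\<forall>t\<in>J \<inter> V. z t = y t) \<and>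
           (n \<notin> {0<..<1} \<or> (\<forall>t\<in>J. 0 < z t) \<longrightarrow> (\<forall>t\<in>J. z t = y t)))) \<and>
     (\<forall>r s :: int. 1 < n \<and> n \<in> \<rat> \<and> odd s \<and> 1 / (1 - n) = of_int r / of_int s \<longrightarrow>
        (\<forall>t0\<in>I. \<forall>y0. rpow_defined y0 n \<longrightarrow>
          (let y = bernoulli_ivp T \<alpha> p q n a t0 y0; V = bernoulli_ivp_dom T \<alpha> p q n I a t0 y0 in
           subinterval V I \<and> openin (top_of_set I) V \<and>
           bernoulli_ivp_solution_on T \<alpha> p q n t0 y0 V y \<and>
           (\<forall>J z. subinterval J I \<and> bernoulli_ivp_solution_on T \<alpha> p q n t0 y0 J z \<longrightarrow>
              (\<forall>t\<in>J. z t = y t)))))"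
proof -
  interpret bernoulli_equation T p q I a \<alpha> n
    by unfold_locales (use assms in auto)
  have ivp: "bernoulli_ivp T \<alpha> p q n a t0 y0 = formula (const t0 y0)" if "y0 \<noteq> 0 \<or> n < 1" for t0 y0
    using that by (auto simp: bernoulli_ivp_def)
  show ?thesis
  proof (intro conjI allI impI ballI)
    fix C U
    assume "subinterval U I \<and> (\<forall>t\<in>U. bernoulli_root_defined n (bracket C t))"
    then show "solution_on U (formula C)" by (intro formula_solution) auto
  next
    fix t0 y0 U
    assume "t0 \<in> I" and *: "rpow_defined y0 (1 - n) \<and> rpow_defined (rpow y0 (1 - n)) (1 / (1 - n)) \<and>
        rpow (rpow y0 (1 - n)) (1 / (1 - n)) = y0 \<and> subinterval U I \<and> t0 \<in> U \<and>
        (\<forall>t\<in>U. bernoulli_root_defined n (bracket (const t0 y0) t))"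
    \<comment> \<open>Definedness of \<open>y0 ^ (1 - n)\<close> rules out the case in which the
      zero function replaces the formula.\<close>
    then have "y0 \<noteq> 0 \<or> n < 1" using n by (auto simp: rpow_defined_iff)
    note ivp = ivp[OF this]
    show "solution_on U (bernoulli_ivp T \<alpha> p q n a t0 y0)"
      unfolding ivp using * by (intro formula_solution) auto
    show "bernoulli_ivp T \<alpha> p q n a t0 y0 t0 = y0"
      unfolding ivp using * by (simp add: bernoulli_formula_def bracket_const)
  next
    fix t0 y0 :: real
    assume t0: "t0 \<in> I" and y0: "0 < y0"
    then have nz: "y0 \<noteq> 0" and odd: "y0 < 0 \<longrightarrow> odd_fraction (1 - n)" by auto
    have "bernoulli_ivp_solution_on T \<alpha> p q n t0 y0 (sol_dom t0 y0) (bernoulli_ivp T \<alpha> p q n a t0 y0)"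
      using y0 by (intro ivp_solution_dom t0 nz) auto
    moreover have "z t = formula (const t0 y0) t"
      if "subinterval J I" "bernoulli_ivp_solution_on T \<alpha> p q n t0 y0 J z"
        "t \<in> J \<inter> sol_dom t0 y0" for J z t
      using that positive_solution_unique_dom[OF t0 y0] by (auto simp: bernoulli_ivp_solution_on_def)
    moreover have "z t = formula (const t0 y0) t"
      if "subinterval J I" "bernoulli_ivp_solution_on T \<alpha> p q n t0 y0 J z"
        "n \<notin> {0<..<1} \<or> (\<forall>t\<in>J. 0 < z t)" "t \<in> J" for J z t
      using that positive_solution_unique[OF y0] unfolding bernoulli_ivp_solution_on_def by blast
    moreover note ivp_domain(1,2)[OF t0 nz odd]
    ultimately show "let y = bernoulli_ivp T \<alpha> p q n a t0 y0; V = sol_dom t0 y0 in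
        subinterval V I \<and> openin (top_of_set I) V \<and>
        bernoulli_ivp_solution_on T \<alpha> p q n t0 y0 V y \<and>
        (\<forall>J z. subinterval J I \<and> bernoulli_ivp_solution_on T \<alpha> p q n t0 y0 J z \<longrightarrow>
           (\<forall>t\<in>J \<inter> V. z t = y t) \<and>
           (n \<notin> {0<..<1} \<or> (\<forall>t\<in>J. 0 < z t) \<longrightarrow> (\<forall>t\<in>J. z t = y t)))"
      using ivp nz unfolding Let_def by metis
  next
    fix r s :: int and t0 y0 :: real
    assume rs: "1 < n \<and> n \<in> \<rat> \<and> odd s \<and> 1 / (1 - n) = of_int r / of_int s"
      and t0: "t0 \<in> I" and def: "rpow_defined y0 n"
    \<comment> \<open>For \<open>y0 < 0\<close>, definedness of \<open>y0 ^ n\<close> gives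
      \<open>n\<close> an odd denominator, and the oddness of \<open>s\<close> then makes the
      numerator of \<open>1 - n\<close> odd.\<close>
    have odd: "odd_fraction (1 - n)" if "y0 < 0" 
      using rs def that by (intro odd_fraction_one_minusI[of n s r]) (auto simp: rpow_defined_iff)
    have sol: "subinterval (sol_dom t0 y0) I \<and> openin (top_of_set I) (sol_dom t0 y0) \<and>
        bernoulli_ivp_solution_on T \<alpha> p q n t0 y0 (sol_dom t0 y0) (bernoulli_ivp T \<alpha> p q n a t0 y0)"
    proof (cases "y0 = 0")
      case True
      have I: "subinterval I I" using interval interior by (simp add: subinterval_def)
      \<comment> \<open>As \<open>n > 1\<close>, \<open>0 ^ n\<close> is defined and equal to
        \<open>0\<close>, so the zero function solves the equation on the whole of
        \<open>I\<close>.\<close>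
      have "solution_on I (\<lambda>t. 0)"
        using rs unfolding solution_on_iff[OF I] by (simp add: rpow_zero rpow_defined_iff)
      moreover have "sol_dom t0 y0 = I" "bernoulli_ivp T \<alpha> p q n a t0 y0 = (\<lambda>t. 0)"
        using rs True by (auto simp: bernoulli_ivp_dom_def bernoulli_ivp_def)
      ultimately show ?thesis using I t0 True by (simp add: bernoulli_ivp_solution_on_def)
    next
      case False
      moreover have "y0 < 0 \<longrightarrow> odd_fraction (1 - n)" using odd by blast
      ultimately show ?thesis using ivp_domain(1,2)[OF t0] ivp_solution_dom[OF t0] odd by blast
    qed
    moreover have "z t = bernoulli_ivp T \<alpha> p q n a t0 y0 t"
      if "subinterval J I" "bernoulli_ivp_solution_on T \<alpha> p q n t0 y0 J z" "t \<in> J" for J z t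
      using that rs odd solution_unique_superlinear[of J z t0 t]
      by (auto simp: bernoulli_ivp_solution_on_def)
    ultimately show "let y = bernoulli_ivp T \<alpha> p q n a t0 y0; V = sol_dom t0 y0 in
        subinterval V I \<and> openin (top_of_set I) V \<and>
        bernoulli_ivp_solution_on T \<alpha> p q n t0 y0 V y \<and>
        (\<forall>J z. subinterval J I \<and> bernoulli_ivp_solution_on T \<alpha> p q n t0 y0 J z \<longrightarrow>
           (\<forall>t\<in>J. z t = y t))"
      unfolding Let_def by blast
  qed
qed

end
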